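(* Let $M$ and $M'$ be $n$-layered models over a signature $\Delta^n$ and let $B=(B_k)_{k\in\{0,\dots,n\}}$ be an $n$-layered bisimulation between $M$ and $M'$. Then for every $k\in\{0,\dots,n\}$, every $(w_0,\dots,w_k)$ and $(w'_0,\dots,w'_k)$ with $(w_0,\dots,w_k)B_k(w'_0,\dots,w'_k)$, and every $\varphi\in SFm(k,\Delta^n)$, \[M_k,w_0,\dots,w_k\models_k\varphi\quad\text{iff}\quad M'_k,w'_0,\dots,w'_k\models_k\varphi.\]
   Context: Notation. For $P\subseteq S_0\times\dots\times S_n$ and $k\le n$, $P|_k\subseteq S_0\times\dots\times S_k$ is the set of $(s_0,\dots,s_k)$ such that $(s_0,\dots,s_n)\in P$ for some $s_{k+1},\dots,s_n$. Signatures. An $n$-layered signature $\Delta^n=(\mathrm{Prop}_k,\mathrm{Nom}_k)_{k\in\{0,\dots,n\}}$ is a family of pairwise disjoint, possibly empty, sets of propositions $p_k\in\mathrm{Prop}_k$ and nominals $i_k\in\mathrm{Nom}_k$. Strict formulas. For $k\in\{0,\dots,n\}$, $SFm(k,\Delta^n)$ is the set of formulas generated by $\varphi::= p_k\mid i_k\mid\neg\varphi\mid\varphi\wedge\varphi\mid @_{i_k}\varphi\mid\Diamond_k\varphi$ with $p_k\in\mathrm{Prop}_k$, $i_k\in\mathrm{Nom}_k$. Models. An $n$-layered model $M=(W^n,D^n,R^n,V^n)$ over $\Delta^n$ consists of: pairwise disjoint sets $W_0,\dots,W_n$; a predicate $D^n\subseteq W_0\times\dots\times W_n$ such that, writing $D_k=D^n|_k$,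 for each $k$, $W_k=\{v_k\mid (w_0,\dots,w_{k-1},v_k)\in D_k\text{ for some }(w_0,\dots,w_{k-1})\in D_{k-1}\}$; relations $R_k\subseteq D_k\times D_k$ ($k\le n$); valuations $V^{\mathrm{Prop}}_0:\mathrm{Prop}_0\to\mathcal P(W_0)$, $V^{\mathrm{Prop}}_k:\mathrm{Prop}_k\times D_{k-1}\to\mathcal P(W_k)$ for $k\ge1$, and $V^{\mathrm{Nom}}_k:\mathrm{Nom}_k\to W_k$. The $k$-restriction $M_k$ keeps only the components of levels $\le k$ (with $D_k$ in place of $D^n$). Primed symbols ($W'_k,D'_k,R'_k,V'$) denote the components of $M'$. Satisfaction of strict formulas. For $(w_0,\dots,w_k)\in D_k$: - $p_k$: holds iff $w_0\in V^{\mathrm{Prop}}_0(p_0)$ when $k=0$, and iff $w_k\in V^{\mathrm{Prop}}_k(p_k,(w_0,\dots,w_{k-1}))$ when $k\ge1$; - $i_k$: iff $w_k=V^{\mathrm{Nom}}_k(i_k)$ and $(w_0,\dots,w_{k-1},V^{\mathrm{Nom}}_k(i_k))\in D_k$; - $\neg,\wedge$: as usual; - $@_{i_k}\varphi$: iff $(w_0,\dots,w_{k-1},V^{\mathrm{Nom}}_k(i_k))\in D_k$ and $M_k,w_0,\dots,w_{k-1},V^{\mathrm{Nom}}_k(i_k)\models_k\varphi$; - $\Diamond_k\varphi$: iff there is $(v_0,\dots,v_k)$ with $(w_0,\dots,w_k)R_k(v_0,\dots,v_k)$ and $M_k,v_0,\dots,v_k\models_k\varphi$. $n$-layered bisimulation.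 A family $B=(B_k\subseteq D_k\times D'_k)_{k\in\{0,\dots,n\}}$ is an $n$-layered bisimulation between $M$ and $M'$ if for every $k$ and every $(w_0,\dots,w_k)B_k(w'_0,\dots,w'_k)$: (ATOM$_k$) 1. for each $p_k\in\mathrm{Prop}_k$: if $k=0$, $w_0\in V^{\mathrm{Prop}}_0(p_0)$ iff $w'_0\in V'^{\mathrm{Prop}}_0(p_0)$; if $k\ge1$, $w_k\in V^{\mathrm{Prop}}_k(p_k,(w_0,\dots,w_{k-1}))$ iff $w'_k\in V'^{\mathrm{Prop}}_k(p_k,(w'_0,\dots,w'_{k-1}))$. 2. for each $i_k\in\mathrm{Nom}_k$: (i) if $k=0$, $V^{\mathrm{Nom}}_0(i_0)\,B_0\,V'^{\mathrm{Nom}}_0(i_0)$; if $k\ge1$, $(w_0,\dots,w_{k-1},V^{\mathrm{Nom}}_k(i_k))\,B_k\,(w'_0,\dots,w'_{k-1},V'^{\mathrm{Nom}}_k(i_k))$; (ii) [$w_k=V^{\mathrm{Nom}}_k(i_k)$ and $(w_0,\dots,w_{k-1},V^{\mathrm{Nom}}_k(i_k))\in D_k$] iff [$w'_k=V'^{\mathrm{Nom}}_k(i_k)$ and $(w'_0,\dots,w'_{k-1},V'^{\mathrm{Nom}}_k(i_k))\in D'_k$]. (ZIG$_k$) for all $(v_0,\dots,v_k)$ with $(w_0,\dots,w_k)R_k(v_0,\dots,v_k)$ there is $(v'_0,\dots,v'_k)$ with $(w'_0,\dots,w'_k)R'_k(v'_0,\dots,v'_k)$ and $(v_0,\dots,v_k)B_k(v'_0,\dots,v'_k)$.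 (ZAG$_k$) for all $(v'_0,\dots,v'_k)$ with $(w'_0,\dots,w'_k)R'_k(v'_0,\dots,v'_k)$ there is $(v_0,\dots,v_k)$ with $(w_0,\dots,w_k)R_k(v_0,\dots,v_k)$ and $(v_0,\dots,v_k)B_k(v'_0,\dots,v'_k)$. *)

theory Defs
  imports Main "HOL-Library.Disjoint_Sets"
begin

text \<open>
  A tuple \<open>(w\<^sub>0, \<dots>, w\<^sub>k)\<close> is a list of length \<open>k + 1\<close>, whose prefix \<open>(w\<^sub>0, \<dots>, w\<^sub>k\<^sub>-\<^sub>1)\<close>
  is \<open>take k ws\<close> (empty for \<open>k = 0\<close>) and whose top component is \<open>ws ! k\<close>.
  Families indexed by \<open>{0..n}\<close> are total functions on \<open>nat\<close> that are only inspected up to \<open>n\<close>.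
\<close>

text \<open>Propositions and nominals have separate types, so they are disjoint from each other by typing.\<close>

record ('p, 'i) signature =
  Props :: "nat \<Rightarrow> 'p set"
  Noms :: "nat \<Rightarrow> 'i set"

definition layered_signature :: "nat \<Rightarrow> ('p, 'i) signature \<Rightarrow> bool" where
  "layered_signature n \<Delta> \<longleftrightarrow>
     disjoint_family_on (Props \<Delta>) {..n} \<and> disjoint_family_on (Noms \<Delta>) {..n}"

datatype ('p, 'i) fm =
    Prp 'p
  | Nml 'i
  | Neg "('p, 'i) fm"
  | Conj "('p, 'i) fm" "('p, 'i) fm"
  | At 'i "('p, 'i) fm"
  | Dia nat "('p, 'i) fm"

inductive_set SFm :: "nat \<Rightarrow> ('p, 'i) signature \<Rightarrow> ('p, 'i) fm set"
  for k :: nat and \<Delta> :: "('p, 'i) signature" where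
  Prp: "p \<in> Props \<Delta> k \<Longrightarrow> Prp p \<in> SFm k \<Delta>"
| Nml: "i \<in> Noms \<Delta> k \<Longrightarrow> Nml i \<in> SFm k \<Delta>"
| Neg: "\<phi> \<in> SFm k \<Delta> \<Longrightarrow> Neg \<phi> \<in> SFm k \<Delta>"
| Conj: "\<phi> \<in> SFm k \<Delta> \<Longrightarrow> \<psi> \<in> SFm k \<Delta> \<Longrightarrow> Conj \<phi> \<psi> \<in> SFm k \<Delta>"
| At: "i \<in> Noms \<Delta> k \<Longrightarrow> \<phi> \<in> SFm k \<Delta> \<Longrightarrow> At i \<phi> \<in> SFm k \<Delta>"
| Dia: "\<phi> \<in> SFm k \<Delta> \<Longrightarrow> Dia k \<phi> \<in> SFm k \<Delta>"

text \<open>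
  \<open>VProp M k p ws\<close> is \<open>V\<^sub>k(p, ws)\<close> for a prefix \<open>ws\<close> of length \<open>k\<close>; the valuation at level 0,
  which takes no prefix, is \<open>VProp M 0 p []\<close>.
\<close>

record ('p, 'i, 'w) model =
  World :: "nat \<Rightarrow> 'w set"
  Def :: "'w list set"
  Rel :: "nat \<Rightarrow> ('w list \<times> 'w list) set"
  VProp :: "nat \<Rightarrow> 'p \<Rightarrow> 'w list \<Rightarrow> 'w set"
  VNom :: "nat \<Rightarrow> 'i \<Rightarrow> 'w"

definition proj_upto :: "'w list set \<Rightarrow> nat \<Rightarrow> 'w list set" where
  "proj_upto P k = take (Suc k) ` P"

abbreviation layer :: "('p, 'i, 'w) model \<Rightarrow> nat \<Rightarrow> 'w list set" where
  "layer M k \<equiv> proj_upto (Def M) k"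

text \<open>The set \<open>D\<^sub>k\<^sub>-\<^sub>1\<close> of possible prefixes at level \<open>k\<close>; at level 0 only the empty tuple.\<close>

definition prefixes :: "('p, 'i, 'w) model \<Rightarrow> nat \<Rightarrow> 'w list set" where
  "prefixes M k = (case k of 0 \<Rightarrow> {[]} | Suc j \<Rightarrow> layer M j)"

definition layered_model ::
  "nat \<Rightarrow> ('p, 'i) signature \<Rightarrow> ('p, 'i, 'w) model \<Rightarrow> bool" where
  "layered_model n \<Delta> M \<longleftrightarrow>
     disjoint_family_on (World M) {..n} \<and>
     Def M \<subseteq> {ws. length ws = Suc n \<and> (\<forall>k\<le>n. ws ! k \<in> World M k)} \<and>
     (\<forall>k\<le>n. World M k = {v. \<exists>ws\<in>prefixes M k. ws @ [v] \<in> layer M k}) \<and>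
     (\<forall>k\<le>n. Rel M k \<subseteq> layer M k \<times> layer M k) \<and>
     (\<forall>k\<le>n. \<forall>p\<in>Props \<Delta> k. \<forall>ws\<in>prefixes M k. VProp M k p ws \<subseteq> World M k) \<and>
     (\<forall>k\<le>n. \<forall>i\<in>Noms \<Delta> k. VNom M k i \<in> World M k)"

definition restriction :: "('p, 'i, 'w) model \<Rightarrow> nat \<Rightarrow> ('p, 'i, 'w) model" where
  "restriction M k =
     \<lparr>World = (\<lambda>j. if j \<le> k then World M j else {}),
      Def = layer M k,
      Rel = (\<lambda>j. if j \<le> k then Rel M j else {}),
      VProp = (\<lambda>j. if j \<le> k then VProp M j else (\<lambda>_ _. {})),
      VNom = (\<lambda>j. if j \<le> k then VNom M j else undefined)\<rparr>"

definition named :: "('p, 'i, 'w) model \<Rightarrow> nat \<Rightarrow> 'w list \<Rightarrow> 'i \<Rightarrow> 'w list" where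
  "named M k ws i = take k ws @ [VNom M k i]"

text \<open>
  \<open>sat k M ws \<phi>\<close> is \<open>M, w\<^sub>0, \<dots>, w\<^sub>k \<Turnstile>\<^sub>k \<phi>\<close>, for a \<open>k\<close>-layered model \<open>M\<close>, \<open>ws \<in> layer M k\<close>
  and \<open>\<phi> \<in> SFm k \<Delta>\<close>; its value on other arguments has no meaning.
\<close>

primrec sat :: "nat \<Rightarrow> ('p, 'i, 'w) model \<Rightarrow> 'w list \<Rightarrow> ('p, 'i) fm \<Rightarrow> bool" where
  "sat k M ws (Prp p) \<longleftrightarrow> ws ! k \<in> VProp M k p (take k ws)"
| "sat k M ws (Nml i) \<longleftrightarrow> ws ! k = VNom M k i \<and> named M k ws i \<in> layer M k"
| "sat k M ws (Neg \<phi>) \<longleftrightarrow> \<not> sat k M ws \<phi>"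
| "sat k M ws (Conj \<phi> \<psi>) \<longleftrightarrow> sat k M ws \<phi> \<and> sat k M ws \<psi>"
| "sat k M ws (At i \<phi>) \<longleftrightarrow> named M k ws i \<in> layer M k \<and> sat k M (named M k ws i) \<phi>"
| "sat k M ws (Dia j \<phi>) \<longleftrightarrow> (\<exists>vs. (ws, vs) \<in> Rel M j \<and> sat k M vs \<phi>)"

definition atom_cond ::
  "('p, 'i) signature \<Rightarrow> ('p, 'i, 'w) model \<Rightarrow> ('p, 'i, 'v) model \<Rightarrow>
   (nat \<Rightarrow> ('w list \<times> 'v list) set) \<Rightarrow> nat \<Rightarrow> 'w list \<Rightarrow> 'v list \<Rightarrow> bool" where
  "atom_cond \<Delta> M M' B k ws ws' \<longleftrightarrow>
     (\<forall>p\<in>Props \<Delta> k. ws ! k \<in> VProp M k p (take k ws) \<longleftrightarrow> ws' ! k \<in> VProp M' k p (take k ws')) \<and>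
     (\<forall>i\<in>Noms \<Delta> k.
        (named M k ws i, named M' k ws' i) \<in> B k \<and>
        (ws ! k = VNom M k i \<and> named M k ws i \<in> layer M k \<longleftrightarrow>
         ws' ! k = VNom M' k i \<and> named M' k ws' i \<in> layer M' k))"

definition zig_cond ::
  "('p, 'i, 'w) model \<Rightarrow> ('p, 'i, 'v) model \<Rightarrow>
   (nat \<Rightarrow> ('w list \<times> 'v list) set) \<Rightarrow> nat \<Rightarrow> 'w list \<Rightarrow> 'v list \<Rightarrow> bool" where
  "zig_cond M M' B k ws ws' \<longleftrightarrow>
     (\<forall>vs. (ws, vs) \<in> Rel M k \<longrightarrow> (\<exists>vs'. (ws', vs') \<in> Rel M' k \<and> (vs, vs') \<in> B k))"

definition zag_cond ::
  "('p, 'i, 'w) model \<Rightarrow> ('p, 'i, 'v) model \<Rightarrow>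
   (nat \<Rightarrow> ('w list \<times> 'v list) set) \<Rightarrow> nat \<Rightarrow> 'w list \<Rightarrow> 'v list \<Rightarrow> bool" where
  "zag_cond M M' B k ws ws' \<longleftrightarrow>
     (\<forall>vs'. (ws', vs') \<in> Rel M' k \<longrightarrow> (\<exists>vs. (ws, vs) \<in> Rel M k \<and> (vs, vs') \<in> B k))"

definition layered_bisimulation ::
  "nat \<Rightarrow> ('p, 'i) signature \<Rightarrow> ('p, 'i, 'w) model \<Rightarrow> ('p, 'i, 'v) model \<Rightarrow>
   (nat \<Rightarrow> ('w list \<times> 'v list) set) \<Rightarrow> bool" where
  "layered_bisimulation n \<Delta> M M' B \<longleftrightarrow>
     (\<forall>k\<le>n. B k \<subseteq> layer M k \<times> layer M' k \<and>
        (\<forall>(ws, ws')\<in>B k.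
           atom_cond \<Delta> M M' B k ws ws' \<and> zig_cond M M' B k ws ws' \<and> zag_cond M M' B k ws ws'))"

end

theory Submission imports Defs begin

text \<open>A formula of \<open>SFm k \<Delta>\<close> speaks of level \<open>k\<close> only, and
  evaluating it moves only between tuples of that level, so \<open>B k\<close> alone matters.
  Restricting to \<open>k\<close> changes nothing that is consulted there: the components at
  \<open>k\<close> are kept, and truncating to \<open>Suc k\<close> entries twice is the same as
  once. The claim follows by induction on the formula, for all related pairs at once: the atom
  condition settles propositions and nominals and keeps named tuples related, while zig and zag
  carry witnesses of a diamond across.\<close>

lemma layer_restriction [simp]: "layer (restriction M k) k = layer M k"
  by (simp add: restriction_def proj_upto_def image_image)

lemma Rel_restriction [simp]: "Rel (restriction M k) k = Rel M k"
  and VProp_restriction [simp]: "VProp (restriction M k) k = VProp M k"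
  and VNom_restriction [simp]: "VNom (restriction M k) k = VNom M k"
  by (simp_all add: restriction_def)

lemma named_restriction [simp]: "named (restriction M k) k ws i = named M k ws i"
  by (simp add: named_def)

lemma layered_bisimulationD:
  assumes "layered_bisimulation n \<Delta> M M' B" "k \<le> n" "(ws, ws') \<in> B k"
  shows "ws \<in> layer M k" "ws' \<in> layer M' k"
    and "atom_cond \<Delta> M M' B k ws ws'" "zig_cond M M' B k ws ws'" "zag_cond M M' B k ws ws'"
  using assms unfolding layered_bisimulation_def by blast+

theorem theorem2:
  fixes n k :: nat
    and \<Delta> :: "('p, 'i) signature"
    and M :: "('p, 'i, 'w) model"
    and M' :: "('p, 'i, 'v) model"
    and B :: "nat \<Rightarrow> ('w list \<times> 'v list) set"
    and ws :: "'w list" and ws' :: "'v list"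
    and \<phi> :: "('p, 'i) fm"
  assumes "layered_signature n \<Delta>"
    and "layered_model n \<Delta> M"
    and "layered_model n \<Delta> M'"
    and "layered_bisimulation n \<Delta> M M' B"
    and "k \<le> n"
    and "(ws, ws') \<in> B k"
    and "\<phi> \<in> SFm k \<Delta>"
  shows "sat k (restriction M k) ws \<phi> \<longleftrightarrow> sat k (restriction M' k) ws' \<phi>"
  \<comment> \<open>Membership in \<open>SFm\<close> comes first to drive the rule induction;
    relatedness is chained in so that the induction hypothesis covers every related pair, since
    \<open>At\<close> and \<open>Dia\<close> move to other tuples.\<close>
  using assms(7,6)
proof (induction \<phi> arbitrary: ws ws' rule: SFm.induct)
  case (Prp p)
  then show ?case
    using layered_bisimulationD(3)[OF assms(4,5)] by (simp add: atom_cond_def)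
next
  case (Nml i)
  then show ?case
    using layered_bisimulationD(3)[OF assms(4,5)] by (simp add: atom_cond_def)
next
  case (Neg \<phi>)
  then show ?case by simp
next
  case (Conj \<phi> \<psi>)
  then show ?case by simp
next
  case (At i \<phi>)
  \<comment> \<open>Being related puts both named tuples in their layers, so the definedness
    conjunct of \<open>At\<close> holds on both sides and only the induction hypothesis at this pair
    remains.\<close>
  have named: "(named M k ws i, named M' k ws' i) \<in> B k"
    using layered_bisimulationD(3)[OF assms(4,5) At.prems] At.hyps(1) by (simp add: atom_cond_def)
  then show ?case
    using layered_bisimulationD(1,2)[OF assms(4,5) named] At.IH by simp
next
  case (Dia \<phi>)
  \<comment> \<open>Strictness fixes the index of the diamond to \<open>k\<close>, the level of
    these conditions; zig gives the forward implication, zag the converse.\<close>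
  have "zig_cond M M' B k ws ws'" "zag_cond M M' B k ws ws'"
    using layered_bisimulationD(4,5)[OF assms(4,5) Dia.prems] .
  then show ?case
    unfolding zig_cond_def zag_cond_def sat.simps Rel_restriction using Dia.IH by blast
qed

end
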